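(* Let $G=(V,E)$ be a finite connected graph with graph distance $d$, and let $\mu$ be a balanced probability measure on $V$ whose support $\operatorname{supp}\mu=\{v\in V:\mu(v)>0\}$ consists of exactly $m$ vertices. Then there exists a map $\phi:V\to\mathbb{R}^m$ such that (i) for all $u,v\in V$, $\|\phi(u)-\phi(v)\|_{\ell^1(\mathbb{R}^m)}\le d(u,v)$; (ii) for some $\alpha$ with $\mathrm{diam}(G)/2\le\alpha\le\mathrm{diam}(G)$, $$\phi(\operatorname{supp}\mu)\subset\{x\in\mathbb{R}^m_{\ge0}: x_1+\dots+x_m=\alpha\};$$ (iii) for every $v\in\operatorname{supp}\mu$, $$\frac{1}{\#\operatorname{supp}\mu}\sum_{w\in\operatorname{supp}\mu}\|\phi(v)-\phi(w)\|_{\ell^\infty(\mathbb{R}^m)}\ge\frac{\mathrm{diam}(G)}{2m}.$$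
   Context: $d$ is the shortest-path distance and $\mathrm{diam}(G)=\max_{u,v}d(u,v)$. A probability measure $\mu$ on $V$ is called balanced if for every $w\in V$ with $\mu(w)>0$, $$\sum_{u\in V}d(w,u)\mu(u)=\max_{w'\in V}\sum_{u\in V}d(w',u)\mu(u),$$ i.e. the function $T(w)=\sum_{u}d(w,u)\mu(u)$ attains its global maximum at every vertex of the support of $\mu$. *)

theory Defs
  imports
    "HOL-Analysis.Analysis"
    "HOL-Probability.Probability_Mass_Function"
    "Graph_Theory.Graph_Theory"
begin

text \<open>
  The shortest-path cost \<^const>\<open>wf_digraph.\<mu>\<close> with unit arc costs has type \<^typ>\<open>ereal\<close>; it is
  finite between any two vertices of a connected undirected graph, which is the only case in
  which the following real-valued version is meaningful.
\<close>

definition graph_dist :: "('a, 'b) pre_digraph \<Rightarrow> 'a \<Rightarrow> 'a \<Rightarrow> real" where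
  "graph_dist G u v = real_of_ereal (wf_digraph.\<mu> G (\<lambda>_. 1) u v)"

definition graph_diam :: "('a, 'b) pre_digraph \<Rightarrow> real" where
  "graph_diam G = Max ((\<lambda>(u, v). graph_dist G u v) ` (verts G \<times> verts G))"

definition transport :: "('a, 'b) pre_digraph \<Rightarrow> 'a pmf \<Rightarrow> 'a \<Rightarrow> real" where
  "transport G \<mu> w = (\<Sum>u\<in>verts G. graph_dist G w u * pmf \<mu> u)"

text \<open>
  A probability measure on \<^term>\<open>verts G\<close> is a \<^type>\<open>pmf\<close> on the ambient vertex type that is
  supported on \<^term>\<open>verts G\<close>.
\<close>

definition balanced :: "('a, 'b) pre_digraph \<Rightarrow> 'a pmf \<Rightarrow> bool" where
  "balanced G \<mu> \<longleftrightarrow> set_pmf \<mu> \<subseteq> verts G \<and>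
     (\<forall>w\<in>verts G. pmf \<mu> w > 0 \<longrightarrow> transport G \<mu> w = Max (transport G \<mu> ` verts G))"

definition l1_norm :: "real ^ 'n \<Rightarrow> real" where
  "l1_norm x = (\<Sum>i\<in>UNIV. \<bar>x $ i\<bar>)"

text \<open>The \<open>\<ell>\<^sup>\<infinity>\<close> norm on \<^typ>\<open>real ^ 'n\<close> is the library's \<^const>\<open>infnorm\<close>.\<close>

end

theory Submission
  imports Defs
begin

text \<open>
  Enumerate the support as \<open>s\<^sub>1, \<dots>, s\<^sub>m\<close> and put \<open>\<phi>(v)\<^sub>i = \<mu>(s\<^sub>i) d(v, s\<^sub>i)\<close>. The triangle inequality
  makes \<open>\<phi>\<close> a contraction, and the coordinates of \<open>\<phi>(v)\<close> add up to the transport cost \<open>T(v)\<close>,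
  which is the constant \<open>\<alpha> = max T\<close> on the support. For a diametral pair \<open>(u, v)\<close> one has
  \<open>T(u) + T(v) \<ge> d(u, v)\<close>, so \<open>\<alpha>\<close> is at least half the diameter. Since \<open>\<phi>(s\<^sub>i)\<^sub>i = 0\<close>, the \<open>\<ell>\<^sup>\<infinity>\<close>
  distance of \<open>\<phi>(v)\<close> and \<open>\<phi>(s\<^sub>i)\<close> is at least \<open>\<mu>(s\<^sub>i) d(v, s\<^sub>i)\<close>, and these bounds again sum to \<open>T(v)\<close>.
\<close>

lemma (in wf_digraph) awalk_cost_unit: "awalk_cost (\<lambda>_. 1) p = length p"
  by (induct p) auto

text \<open>Symmetry supplies an opposite arc for each arc of the walk. These may be different arcs,
  so only the length carries over, which is all that unit costs see.\<close>

lemma (in sym_digraph) ex_awalk_rev: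
  assumes "awalk u p v"
  shows "\<exists>q. awalk v q u \<and> length q = length p"
  using assms
proof (induct p arbitrary: u)
  case Nil
  then show ?case by (intro exI[of _ "[]"]) (auto simp: awalk_Nil_iff)
next
  case (Cons e p)
  then have e: "e \<in> arcs G" "tail G e = u" and "awalk (head G e) p v"
    by (auto simp: awalk_Cons_iff)
  then obtain q where q: "awalk v q (head G e)" "length q = length p"
    using Cons.hyps by blast
  obtain e' where "e' \<in> arcs G" "tail G e' = head G e" "head G e' = u"
    using sym_arcs e unfolding symmetric_conv by metis
  then have "awalk (head G e) [e'] u"
    by (auto simp: awalk_Cons_iff awalk_Nil_iff)
  with q have "awalk v (q @ [e']) u" "length (q @ [e']) = length (e # p)"
    by (auto intro: awalk_appendI)
  then show ?case by blast
qed

text \<open>Nonnegative costs on a finite digraph have a minimum attained by a path, so the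
  extended-real cost is finite here and the metric axioms reduce to operations on walks.\<close>

lemma (in fin_digraph) graph_dist_awalk:
  assumes "u \<rightarrow>\<^sup>* v"
  obtains p where "awalk u p v" "graph_dist G u v = length p"
proof -
  obtain p where "apath u p v" "\<mu> (\<lambda>_. 1) u v = awalk_cost (\<lambda>_. 1) p"
    using min_cost_awalk[OF assms, of "\<lambda>_. 1"] by auto
  then show ?thesis
    by (intro that[of p]) (auto simp: graph_dist_def apath_def awalk_cost_unit)
qed

lemma (in fin_digraph) graph_dist_nonneg:
  assumes "u \<rightarrow>\<^sup>* v"
  shows "0 \<le> graph_dist G u v"
  using graph_dist_awalk[OF assms] by (metis of_nat_0_le_iff)

lemma (in fin_digraph) graph_dist_le_length:
  assumes "awalk u p v"
  shows "graph_dist G u v \<le> length p"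
proof -
  have "u \<rightarrow>\<^sup>* v" using assms by (auto simp: reachable_awalk)
  \<comment> \<open>Finiteness comes first: \<open>real_of_ereal\<close> sends infinite values to 0,
    so an inequality in \<open>ereal\<close> need not survive the conversion.\<close>
  then obtain q where "\<mu> (\<lambda>_. 1) u v = ereal (awalk_cost (\<lambda>_. 1) q)"
    using min_cost_awalk[of u v "\<lambda>_. 1"] by auto
  moreover have "\<mu> (\<lambda>_. 1) u v \<le> ereal (length p)"
    using min_cost_le_walk_cost[OF assms, of "\<lambda>_. 1"] by (simp add: awalk_cost_unit)
  ultimately show ?thesis by (simp add: graph_dist_def)
qed

lemma (in fin_digraph) graph_dist_refl:
  assumes "v \<in> verts G"
  shows "graph_dist G v v = 0"
proof -
  have "graph_dist G v v \<le> length ([] :: 'b list)"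
    using assms by (intro graph_dist_le_length) (simp add: awalk_Nil_iff)
  moreover have "0 \<le> graph_dist G v v"
    using assms by (intro graph_dist_nonneg) simp
  ultimately show ?thesis by simp
qed

lemma (in fin_digraph) graph_dist_triangle:
  assumes "u \<rightarrow>\<^sup>* v" and "v \<rightarrow>\<^sup>* w"
  shows "graph_dist G u w \<le> graph_dist G u v + graph_dist G v w"
proof -
  obtain p where p: "awalk u p v" "graph_dist G u v = length p"
    using graph_dist_awalk[OF assms(1)] .
  obtain q where q: "awalk v q w" "graph_dist G v w = length q"
    using graph_dist_awalk[OF assms(2)] .
  have "awalk u (p @ q) w" using p(1) q(1) by (rule awalk_appendI)
  from graph_dist_le_length[OF this] p(2) q(2) show ?thesis by simp
qed

lemma (in pseudo_graph) graph_dist_sym: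
  assumes "u \<rightarrow>\<^sup>* v"
  shows "graph_dist G u v = graph_dist G v u"
proof -
  have le: "graph_dist G y x \<le> graph_dist G x y" if "x \<rightarrow>\<^sup>* y" for x y
  proof -
    obtain p where "awalk x p y" "graph_dist G x y = length p"
      using graph_dist_awalk[OF \<open>x \<rightarrow>\<^sup>* y\<close>] .
    then show ?thesis using ex_awalk_rev graph_dist_le_length by metis
  qed
  show ?thesis
    using le[OF assms] le[OF symmetric_reachable'[OF assms]] by simp
qed

theorem theorem2:
  fixes G :: "('a, 'b) pre_digraph" and \<mu> :: "'a pmf"
  assumes "graph G" and "Digraph_Component.connected G"
    and "balanced G \<mu>"
    and "card (set_pmf \<mu>) = CARD('m::finite)"
  shows "\<exists>\<phi> :: 'a \<Rightarrow> real ^ 'm.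
    (\<forall>u\<in>verts G. \<forall>v\<in>verts G. l1_norm (\<phi> u - \<phi> v) \<le> graph_dist G u v) \<and>
    (\<exists>\<alpha>. graph_diam G / 2 \<le> \<alpha> \<and> \<alpha> \<le> graph_diam G \<and>
      \<phi> ` set_pmf \<mu> \<subseteq> {x. (\<forall>i. 0 \<le> x $ i) \<and> (\<Sum>i\<in>UNIV. x $ i) = \<alpha>}) \<and>
    (\<forall>v\<in>set_pmf \<mu>.
      1 / real (card (set_pmf \<mu>)) * (\<Sum>w\<in>set_pmf \<mu>. infnorm (\<phi> v - \<phi> w))
        \<ge> graph_diam G / (2 * real CARD('m)))"
proof -
  interpret graph G by fact
  let ?d = "graph_dist G" and ?D = "graph_diam G" and ?S = "set_pmf \<mu>" and ?T = "transport G \<mu>"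
  \<comment> \<open>\<open>connected\<close> ignores the direction of arcs, whereas the distance
    lemmas ask for directed reachability; symmetry of the arcs bridges the two.\<close>
  have reach: "u \<rightarrow>\<^sup>*\<^bsub>G\<^esub> v" if "u \<in> verts G" "v \<in> verts G" for u v
    using symmetric_connected_imp_strongly_connected[OF sym_arcs assms(2)] that
    by (auto simp: strongly_connected_def)
  have ne: "verts G \<noteq> {}"
    using assms(2) by (simp add: connected_conv)
  have S: "?S \<subseteq> verts G"
    and T_max: "\<And>w. w \<in> ?S \<Longrightarrow> ?T w = Max (?T ` verts G)"
    using assms(3) by (auto simp: balanced_def pmf_positive)
  have finS: "finite ?S" using S finite_verts by (rule finite_subset)
  have sum_pmf: "(\<Sum>u\<in>verts G. pmf \<mu> u) = 1"
    using S by (intro sum_pmf_eq_1) auto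
  have diam_ge: "?d u v \<le> ?D" if "u \<in> verts G" "v \<in> verts G" for u v
    unfolding graph_diam_def using that by (intro Max_ge) auto
  \<comment> \<open>\<open>?T w\<close> is a \<mu>-average of distances, each at most the
    diameter.\<close>
  have T_le: "?T w \<le> ?D" if "w \<in> verts G" for w
  proof -
    have "?T w \<le> (\<Sum>u\<in>verts G. ?D * pmf \<mu> u)"
      unfolding transport_def using that by (intro sum_mono mult_right_mono diam_ge) auto
    then show ?thesis using sum_pmf by (simp flip: sum_distrib_left)
  qed
  define \<alpha> where "\<alpha> = Max (?T ` verts G)"
  have "\<alpha> \<in> ?T ` verts G"
    unfolding \<alpha>_def using ne by (intro Max_in) auto
  then have \<alpha>_le: "\<alpha> \<le> ?D" using T_le by auto
  have \<alpha>_ge: "?D / 2 \<le> \<alpha>"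
  proof -
    have "?D \<in> (\<lambda>(u, v). ?d u v) ` (verts G \<times> verts G)"
      unfolding graph_diam_def using ne by (intro Max_in) auto
    then obtain x y where xy: "x \<in> verts G" "y \<in> verts G" "?D = ?d x y" by auto
    \<comment> \<open>Write the diameter as the \<mu>-average of a constant, then apply the triangle
      inequality through each \<open>u\<close>.\<close>
    have "?D = (\<Sum>u\<in>verts G. ?d x y * pmf \<mu> u)"
      using sum_pmf xy(3) by (simp flip: sum_distrib_left)
    also have "\<dots> \<le> (\<Sum>u\<in>verts G. (?d x u + ?d y u) * pmf \<mu> u)"
    proof (intro sum_mono mult_right_mono)
      fix u assume u: "u \<in> verts G"
      show "?d x y \<le> ?d x u + ?d y u"
        using graph_dist_triangle[OF reach[OF xy(1) u] reach[OF u xy(2)]]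
          graph_dist_sym[OF reach[OF u xy(2)]] by simp
    qed simp
    also have "\<dots> = ?T x + ?T y"
      by (simp add: transport_def distrib_right sum.distrib)
    also have "\<dots> \<le> \<alpha> + \<alpha>"
      unfolding \<alpha>_def using xy by (intro add_mono Max_ge) auto
    finally show ?thesis by simp
  qed
  have T_supp: "(\<Sum>u\<in>?S. pmf \<mu> u * ?d w u) = ?T w" for w
    unfolding transport_def using S
    by (intro sum.mono_neutral_cong_left) (auto simp: set_pmf_iff mult.commute)
  \<comment> \<open>The cardinality hypothesis lets the coordinate type itself enumerate the
    support.\<close>
  obtain s :: "'m \<Rightarrow> 'a" where s: "bij_betw s UNIV ?S"
    using finite_same_card_bij[OF finite finS] assms(4) by metis
  have s_verts: "s i \<in> verts G" for i
    using S bij_betwE[OF s] by auto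
  have sum_s: "(\<Sum>i\<in>UNIV. f (s i)) = sum f ?S" for f :: "'a \<Rightarrow> real"
    using s by (rule sum.reindex_bij_betw)
  define \<phi> :: "'a \<Rightarrow> real ^ 'm" where "\<phi> v = (\<chi> i. pmf \<mu> (s i) * ?d v (s i))" for v
  have sum_\<phi>: "(\<Sum>i\<in>UNIV. \<phi> v $ i) = ?T v" for v
    by (simp add: \<phi>_def sum_s[of "\<lambda>u. pmf \<mu> u * ?d v u"] T_supp)
  have "l1_norm (\<phi> u - \<phi> v) \<le> ?d u v" if uv: "u \<in> verts G" "v \<in> verts G" for u v
  proof -
    have "l1_norm (\<phi> u - \<phi> v) \<le> (\<Sum>i\<in>UNIV. pmf \<mu> (s i) * ?d u v)"
      unfolding l1_norm_def
    proof (intro sum_mono)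
      fix i
      \<comment> \<open>Reverse triangle inequality: the two instances bound the difference from
        above and from below.\<close>
      have "\<bar>?d u (s i) - ?d v (s i)\<bar> \<le> ?d u v"
        using graph_dist_triangle[OF reach[OF uv] reach[OF uv(2) s_verts], of i]
          graph_dist_triangle[OF reach[OF uv(2,1)] reach[OF uv(1) s_verts], of i]
          graph_dist_sym[OF reach[OF uv]] by simp
      moreover have "\<bar>(\<phi> u - \<phi> v) $ i\<bar> = pmf \<mu> (s i) * \<bar>?d u (s i) - ?d v (s i)\<bar>"
        by (simp add: \<phi>_def abs_mult flip: right_diff_distrib)
      ultimately show "\<bar>(\<phi> u - \<phi> v) $ i\<bar> \<le> pmf \<mu> (s i) * ?d u v"
        by (simp add: mult_left_mono)
    qed
    \<comment> \<open>The weights \<open>pmf \<mu> (s i)\<close> exhaust the support, so they sum to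
      1.\<close>
    also have "\<dots> = ?d u v"
      using sum_s[of "pmf \<mu>"] sum_pmf_eq_1[OF finS order_refl] by (simp flip: sum_distrib_right)
    finally show ?thesis .
  qed
  moreover have "\<phi> ` ?S \<subseteq> {x. (\<forall>i. 0 \<le> x $ i) \<and> (\<Sum>i\<in>UNIV. x $ i) = \<alpha>}"
  proof (intro image_subsetI CollectI conjI allI)
    fix v i assume v: "v \<in> ?S"
    show "0 \<le> \<phi> v $ i"
      using v S s_verts by (auto simp: \<phi>_def intro!: mult_nonneg_nonneg graph_dist_nonneg reach)
    show "(\<Sum>i\<in>UNIV. \<phi> v $ i) = \<alpha>"
      using T_max[OF v] by (simp add: sum_\<phi> \<alpha>_def)
  qed
  moreover have "1 / real (card ?S) * (\<Sum>w\<in>?S. infnorm (\<phi> v - \<phi> w)) \<ge> ?D / (2 * real CARD('m))"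
    if v: "v \<in> ?S" for v
  proof -
    have "\<alpha> = (\<Sum>i\<in>UNIV. \<phi> v $ i)"
      using T_max[OF v] by (simp add: sum_\<phi> \<alpha>_def)
    also have "\<dots> \<le> (\<Sum>i\<in>UNIV. infnorm (\<phi> v - \<phi> (s i)))"
    proof (intro sum_mono)
      fix i
      have "\<phi> (s i) $ i = 0"
        using s_verts by (simp add: \<phi>_def graph_dist_refl)
      then show "\<phi> v $ i \<le> infnorm (\<phi> v - \<phi> (s i))"
        using component_le_infnorm_cart[of "\<phi> v - \<phi> (s i)" i] by simp
    qed
    also have "\<dots> = (\<Sum>w\<in>?S. infnorm (\<phi> v - \<phi> w))"
      by (rule sum_s)
    finally have "?D / 2 \<le> (\<Sum>w\<in>?S. infnorm (\<phi> v - \<phi> w))"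
      using \<alpha>_ge by simp
    then have "?D / 2 / real CARD('m) \<le> (\<Sum>w\<in>?S. infnorm (\<phi> v - \<phi> w)) / real CARD('m)"
      by (rule divide_right_mono) simp
    then show ?thesis using assms(4) by simp
  qed
  ultimately show ?thesis
    using \<alpha>_le \<alpha>_ge by blast
qed

end
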